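(* Let $1<a\le 2$ and let $\varphi:[0,1)\to\left[0,\frac{1}{a-1}\right]$ be the function defined by $\varphi\left(\sum_{n=1}^{\infty}\frac{\alpha_n}{2^n}\right)=\sum_{n=1}^{\infty}\frac{\alpha_n}{a^n}$, where $(\alpha_n)$, $\alpha_n\in\{0,1\}$, is the binary expansion of the argument that does not end in an infinite string of $1$s. Then $\varphi$ is a solution of the system of functional equations $$\begin{cases}\varphi\left(\frac{x}{2}\right)=\frac{1}{a}\varphi(x),\\ \varphi\left(\frac12+\frac{x}{2}\right)=\frac1a+\frac1a\varphi(x),\end{cases}$$ i.e. both equalities hold for every $x\in[0,1)$.
   Context: Every $x\in[0,1)$ has a unique binary expansion $x=\sum_{n\ge1}\alpha_n2^{-n}$ with $\alpha_n\in\{0,1\}$ that is not eventually equal to $1$; this expansion is the one used to define $\varphi(x)$. *)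

theory Defs imports Complex_Main begin

text \<open>Digit sequences are indexed from 0, so \<open>\<alpha> n\<close> is the digit with weight \<open>1 / 2 ^ Suc n\<close>.\<close>

definition is_binary_expansion :: "(nat \<Rightarrow> nat) \<Rightarrow> real \<Rightarrow> bool" where
  "is_binary_expansion \<alpha> x \<longleftrightarrow>
     (\<forall>n. \<alpha> n \<in> {0, 1}) \<and>
     (\<lambda>n. real (\<alpha> n) / 2 ^ Suc n) sums x \<and>
     \<not> (\<forall>\<^sub>F n in sequentially. \<alpha> n = 1)"

text \<open>Meaningful only for \<open>x \<in> {0..<1}\<close>, where the expansion exists and is unique.\<close>

definition binary_expansion :: "real \<Rightarrow> nat \<Rightarrow> nat" where
  "binary_expansion x = (THE \<alpha>. is_binary_expansion \<alpha> x)"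

definition phi :: "real \<Rightarrow> real \<Rightarrow> real" where
  "phi a x = (\<Sum>n. real (binary_expansion x n) / a ^ Suc n)"

end

theory Submission imports Defs begin

text \<open>Prepending a digit \<open>d\<close> to the expansion of \<open>x\<close> gives the expansion of \<open>(d + x) / 2\<close>, and on
  the side of \<open>phi\<close> it shifts the series by one index. Conversely, deleting the first digit
  of an expansion of \<open>x\<close> leaves an expansion of \<open>2 * x - d\<close>; as this number lies in
  \<open>[0, 1)\<close>, the first digit is forced, and so inductively are all others.\<close>

text \<open>Strictness at 1 is where the ban on a tail of ones enters: it yields some digit 0, and
  there the series falls strictly below the all-ones series, whose sum is 1.\<close>

lemma is_binary_expansion_bounds:
  assumes "is_binary_expansion \<alpha> x"
  shows "0 \<le> x" and "x < 1"
proof -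
  have dig: "\<And>n. \<alpha> n \<in> {0, 1}"
    and sums: "(\<lambda>n. real (\<alpha> n) / 2 ^ Suc n) sums x"
    and ne: "\<not> (\<forall>\<^sub>F n in sequentially. \<alpha> n = 1)"
    using assms by (auto simp: is_binary_expansion_def)
  show "0 \<le> x"
    by (rule sums_le[OF _ sums_zero sums]) auto
  have "\<not> (\<forall>n. \<alpha> n = 1)"
    using ne always_eventually by blast
  then obtain m where m: "\<alpha> m = 0"
    using dig by blast
  have gap: "(\<lambda>n. (1 / 2) ^ Suc n - real (\<alpha> n) / 2 ^ Suc n) sums (1 - x)"
    by (intro sums_diff power_half_series sums)
  have "0 < (\<Sum>n. (1 / 2) ^ Suc n - real (\<alpha> n) / 2 ^ Suc n)"
  proof (rule suminf_pos2[OF sums_summable[OF gap]])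
    show "0 \<le> (1 / 2) ^ Suc n - real (\<alpha> n) / 2 ^ Suc n" for n
      using dig[of n] by (auto simp: power_divide)
    show "0 < (1 / 2) ^ Suc m - real (\<alpha> m) / 2 ^ Suc m"
      using m by simp
  qed
  then have "0 < 1 - x"
    by (simp only: sums_unique[OF gap, symmetric])
  then show "x < 1"
    by simp
qed

lemma is_binary_expansion_tail:
  assumes "is_binary_expansion \<alpha> x"
  shows "is_binary_expansion (\<lambda>n. \<alpha> (Suc n)) (2 * x - real (\<alpha> 0))"
proof -
  have "(\<lambda>n. real (\<alpha> (Suc n)) / 2 ^ Suc (Suc n)) sums (x - real (\<alpha> 0) / 2)"
    using assms by (subst sums_Suc_iff) (simp add: is_binary_expansion_def)
  from sums_mult[OF this, of 2]
  have "(\<lambda>n. real (\<alpha> (Suc n)) / 2 ^ Suc n) sums (2 * x - real (\<alpha> 0))"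
    by (simp add: algebra_simps)
  \<comment> \<open>Being eventually 1 is insensitive to an index shift, so the tail inherits the
    ban on ending in ones.\<close>
  then show ?thesis
    using assms eventually_sequentially_Suc[of "\<lambda>n. \<alpha> n = 1"]
    by (auto simp: is_binary_expansion_def)
qed

lemma is_binary_expansion_cons:
  assumes "is_binary_expansion \<alpha> x" and "d \<in> {0, 1}"
  shows "is_binary_expansion (case_nat d \<alpha>) ((real d + x) / 2)"
proof -
  have "(\<lambda>n. real (\<alpha> n) / 2 ^ Suc n / 2) sums (x / 2)"
    using assms(1) by (intro sums_divide) (simp add: is_binary_expansion_def)
  then have "(\<lambda>n. real (case_nat d \<alpha> (Suc n)) / 2 ^ Suc (Suc n)) sums (x / 2)"
    by (simp add: mult.commute)
  then have "(\<lambda>n. real (case_nat d \<alpha> n) / 2 ^ Suc n) sums ((real d + x) / 2)"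
    by (subst (asm) sums_Suc_iff) (simp add: add_divide_distrib add.commute)
  then show ?thesis
    using assms eventually_sequentially_Suc[of "\<lambda>n. case_nat d \<alpha> n = 1"]
    by (auto simp: is_binary_expansion_def split: nat.split)
qed

lemma is_binary_expansion_unique:
  assumes "is_binary_expansion \<alpha> x" and "is_binary_expansion \<beta> x"
  shows "\<alpha> = \<beta>"
proof
  fix n
  show "\<alpha> n = \<beta> n"
    using assms
  proof (induction n arbitrary: \<alpha> \<beta> x)
    case 0
    \<comment> \<open>Both \<open>2 * x - real (\<alpha> 0)\<close> and
      \<open>2 * x - real (\<beta> 0)\<close> lie in [0, 1), so the two integers differ by less than
      1.\<close>
    show ?case
      using is_binary_expansion_bounds[OF is_binary_expansion_tail[OF 0(1)]]
        is_binary_expansion_bounds[OF is_binary_expansion_tail[OF 0(2)]] by linarith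
  next
    case (Suc n)
    have "\<alpha> 0 = \<beta> 0"
      using is_binary_expansion_bounds[OF is_binary_expansion_tail[OF Suc.prems(1)]]
        is_binary_expansion_bounds[OF is_binary_expansion_tail[OF Suc.prems(2)]] by linarith
    \<comment> \<open>Equal first digits make both tails expansions of one and the same number; this
      is why \<open>x\<close> is generalised in the induction.\<close>
    then show ?case
      using Suc.IH[OF is_binary_expansion_tail[OF Suc.prems(1)]]
        is_binary_expansion_tail[OF Suc.prems(2)] by simp
  qed
qed

lemma binary_expansion_eq:
  assumes "is_binary_expansion \<alpha> x"
  shows "binary_expansion x = \<alpha>"
  unfolding binary_expansion_def
  using assms is_binary_expansion_unique by blast

text \<open>Rounding down loses less than 1, hence less than \<open>(1 / 2) ^ n\<close> after
  division. The limit serves twice below: to sum the digit series and to exclude a tail of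
  ones.\<close>

lemma floor_pow2_over_pow2_tendsto: "(\<lambda>n. \<lfloor>2 ^ n * x\<rfloor> / 2 ^ n) \<longlonglongrightarrow> (x::real)"
proof (rule tendsto_sandwich)
  have "(\<lambda>n. x - (1 / 2) ^ n) \<longlonglongrightarrow> x - 0"
    by (intro tendsto_intros LIMSEQ_power_zero) simp
  then show "(\<lambda>n. x - (1 / 2) ^ n) \<longlonglongrightarrow> x"
    by simp
  have "x - (1 / 2) ^ n \<le> \<lfloor>2 ^ n * x\<rfloor> / 2 ^ n" for n
  proof -
    have "2 ^ n * x - 1 \<le> \<lfloor>2 ^ n * x\<rfloor>"
      by linarith
    then have "(2 ^ n * x - 1) / 2 ^ n \<le> \<lfloor>2 ^ n * x\<rfloor> / 2 ^ n"
      by (rule divide_right_mono) simp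
    then show ?thesis
      by (simp add: diff_divide_distrib power_divide)
  qed
  then show "\<forall>\<^sub>F n in sequentially. x - (1 / 2) ^ n \<le> \<lfloor>2 ^ n * x\<rfloor> / 2 ^ n"
    by simp
  show "\<forall>\<^sub>F n in sequentially. \<lfloor>2 ^ n * x\<rfloor> / 2 ^ n \<le> x"
    by (simp add: field_simps)
qed simp

lemma binary_expansion_exists:
  assumes "0 \<le> x" and "x < 1"
  shows "\<exists>\<alpha>. is_binary_expansion \<alpha> x"
proof -
  define F where "F n = \<lfloor>2 ^ n * x\<rfloor>" for n
  \<comment> \<open>With this choice the first \<open>n\<close> digits sum to
    \<open>F n / 2 ^ n\<close>, the truncation of \<open>x\<close> to \<open>n\<close> binary
    places. The cast \<open>nat\<close> loses nothing, since the difference is shown to be 0 or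
    1.\<close>
  define \<alpha> where "\<alpha> n = nat (F (Suc n) - 2 * F n)" for n
  have step: "F (Suc n) - 2 * F n \<in> {0, 1}" for n
  proof -
    have "of_int (F n) \<le> 2 ^ n * x" "2 ^ n * x < of_int (F n) + 1"
      by (auto simp: F_def)
    moreover have "of_int (F (Suc n)) \<le> 2 * (2 ^ n * x)" "2 * (2 ^ n * x) < of_int (F (Suc n)) + 1"
      unfolding F_def by (auto simp: mult.assoc)
    ultimately have "F (Suc n) - 2 * F n > -1" "F (Suc n) - 2 * F n < 2"
      by linarith+
    then show ?thesis
      by auto
  qed
  have \<alpha>_eq: "real (\<alpha> n) = F (Suc n) - 2 * F n" for n
    using step[of n] by (auto simp: \<alpha>_def)
  have F0: "F 0 = 0"
    using assms by (simp add: F_def floor_eq_iff)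
  have "(\<lambda>n. F (Suc n) / 2 ^ Suc n - F n / 2 ^ n) sums (x - F 0 / 2 ^ 0)"
    unfolding F_def by (rule telescope_sums[OF floor_pow2_over_pow2_tendsto])
  moreover have "F (Suc n) / 2 ^ Suc n - F n / 2 ^ n = real (\<alpha> n) / 2 ^ Suc n" for n
    by (simp add: \<alpha>_eq field_simps)
  ultimately have sums: "(\<lambda>n. real (\<alpha> n) / 2 ^ Suc n) sums x"
    by (simp add: F0)
  have "\<not> (\<forall>\<^sub>F n in sequentially. \<alpha> n = 1)"
  proof
    assume "\<forall>\<^sub>F n in sequentially. \<alpha> n = 1"
    then obtain N where N: "\<alpha> n = 1" if "n \<ge> N" for n
      by (auto simp: eventually_sequentially)
    \<comment> \<open>A tail of ones would make \<open>(F n + 1) / 2 ^ n\<close>, which exceeds \<open>x\<close>, constant from \<open>N\<close> on,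
      although it also converges to \<open>x\<close>.\<close>
    have F_Suc: "F (Suc n) = 2 * F n + 1" if "n \<ge> N" for n
      using \<alpha>_eq[of n] N[OF that] by simp
    have const: "(F (N + k) + 1) / 2 ^ (N + k) = (F N + 1) / 2 ^ N" for k
    proof (induction k)
      case (Suc k)
      \<comment> \<open>A digit 1 turns \<open>F n + 1\<close> into \<open>2 * F n + 2\<close>,
        exactly twice as much.\<close>
      have "(F (N + Suc k) + 1) / 2 ^ (N + Suc k) = (F (N + k) + 1) / 2 ^ (N + k)"
        using F_Suc[of "N + k"] by (simp add: field_simps)
      with Suc show ?case
        by simp
    qed simp
    have "(\<lambda>n. F n / 2 ^ n + (1 / 2) ^ n) \<longlonglongrightarrow> x + 0"
      unfolding F_def
      by (intro tendsto_add floor_pow2_over_pow2_tendsto LIMSEQ_power_zero) simp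
    then have "(\<lambda>n. (F n + 1) / 2 ^ n) \<longlonglongrightarrow> x"
      by (simp add: add_divide_distrib power_divide)
    from LIMSEQ_ignore_initial_segment[OF this, of N]
    have "(\<lambda>k. (F N + 1) / 2 ^ N) \<longlonglongrightarrow> x"
      using const by (simp add: add.commute)
    then have "x = (F N + 1) / 2 ^ N"
      by (simp add: LIMSEQ_const_iff)
    moreover have "2 ^ N * x < F N + 1"
      by (simp add: F_def)
    ultimately show False
      by simp
  qed
  moreover have "\<alpha> n \<in> {0, 1}" for n
    using step[of n] by (auto simp: \<alpha>_def)
  ultimately show ?thesis
    using sums by (auto simp: is_binary_expansion_def)
qed

text \<open>The all-ones series in base \<open>a\<close> dominates every digit series, giving both
  convergence and the upper end of the range of \<open>phi\<close>.\<close>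

lemma inverse_powers_sums:
  fixes a :: real
  assumes "1 < a"
  shows "(\<lambda>n. 1 / a ^ Suc n) sums (1 / (a - 1))"
proof -
  have "(\<lambda>n. (1 / a) * (1 / a) ^ n) sums ((1 / a) * (1 / (1 - 1 / a)))"
    using assms by (intro sums_mult geometric_sums) simp
  then show ?thesis
    using assms by (simp add: power_divide field_simps)
qed

lemma digit_series_summable:
  fixes a :: real and \<alpha> :: "nat \<Rightarrow> nat"
  assumes "1 < a" and "\<And>n. \<alpha> n \<in> {0, 1}"
  shows "summable (\<lambda>n. real (\<alpha> n) / a ^ Suc n)"
proof (rule summable_comparison_test')
  show "summable (\<lambda>n. 1 / a ^ Suc n)"
    using inverse_powers_sums[OF assms(1)] by (rule sums_summable)
  show "norm (real (\<alpha> n) / a ^ Suc n) \<le> 1 / a ^ Suc n" if "n \<ge> 0" for n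
    using assms(1) assms(2)[of n] by auto
qed

text \<open>The two functional equations are the cases \<open>d = 0\<close> and
  \<open>d = 1\<close>.\<close>

lemma phi_cons:
  assumes "1 < a" and "is_binary_expansion \<alpha> x" and "d \<in> {0, 1}"
  shows "phi a ((real d + x) / 2) = real d / a + 1 / a * phi a x"
proof -
  have dig: "\<alpha> n \<in> {0, 1}" for n
    using assms(2) by (simp add: is_binary_expansion_def)
  have "(\<lambda>n. real (\<alpha> n) / a ^ Suc n) sums phi a x"
    unfolding phi_def binary_expansion_eq[OF assms(2)]
    using digit_series_summable[OF assms(1) dig] by (rule summable_sums)
  then have "(\<lambda>n. 1 / a * (real (\<alpha> n) / a ^ Suc n)) sums (1 / a * phi a x)"
    by (rule sums_mult)
  then have "(\<lambda>n. real (case_nat d \<alpha> (Suc n)) / a ^ Suc (Suc n)) sums (1 / a * phi a x)"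
    by simp
  \<comment> \<open>Restoring the term of index 0 contributes \<open>real d / a\<close>.\<close>
  then have "(\<lambda>n. real (case_nat d \<alpha> n) / a ^ Suc n) sums (real d / a + 1 / a * phi a x)"
    by (subst (asm) sums_Suc_iff) (simp add: add.commute)
  then show ?thesis
    unfolding phi_def[of a "(real d + x) / 2"]
      binary_expansion_eq[OF is_binary_expansion_cons[OF assms(2,3)]]
    by (rule sums_unique[symmetric])
qed

lemma phi_bounds:
  assumes "1 < a" and "is_binary_expansion \<alpha> x"
  shows "phi a x \<in> {0..1 / (a - 1)}"
proof -
  have dig: "\<alpha> n \<in> {0, 1}" for n
    using assms(2) by (simp add: is_binary_expansion_def)
  have sums: "(\<lambda>n. real (\<alpha> n) / a ^ Suc n) sums phi a x"
    unfolding phi_def binary_expansion_eq[OF assms(2)]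
    using digit_series_summable[OF assms(1) dig] by (rule summable_sums)
  have "real (\<alpha> n) / a ^ Suc n \<le> 1 / a ^ Suc n" for n
    using assms(1) dig[of n] by auto
  then have "phi a x \<le> 1 / (a - 1)"
    using sums inverse_powers_sums[OF assms(1)] by (rule sums_le)
  moreover have "0 \<le> phi a x"
    using assms(1) by (intro sums_le[OF _ sums_zero sums]) simp
  ultimately show ?thesis
    by simp
qed

theorem theorem3:
  fixes a :: real
  assumes "1 < a" and "a \<le> 2"
  shows "phi a ` {0..<1} \<subseteq> {0..1 / (a - 1)} \<and>
    (\<forall>x\<in>{0..<1}.
      phi a (x / 2) = 1 / a * phi a x \<and>
      phi a (1 / 2 + x / 2) = 1 / a + 1 / a * phi a x)"
proof (intro conjI ballI image_subsetI)
  fix x :: real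
  assume "x \<in> {0..<1}"
  \<comment> \<open>Existence has to be supplied here: \<open>binary_expansion\<close> is a definite
    description, and its value is known only once some expansion of \<open>x\<close> is at
    hand.\<close>
  then obtain \<alpha> where \<alpha>: "is_binary_expansion \<alpha> x"
    using binary_expansion_exists by auto
  show "phi a x \<in> {0..1 / (a - 1)}"
    using assms(1) \<alpha> by (rule phi_bounds)
  show "phi a (x / 2) = 1 / a * phi a x"
    using phi_cons[OF assms(1) \<alpha>, of 0] by simp
  show "phi a (1 / 2 + x / 2) = 1 / a + 1 / a * phi a x"
    using phi_cons[OF assms(1) \<alpha>, of 1] by (simp add: add_divide_distrib)
qed

end
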